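(* Let $K\in\mathcal S$ and, under the identification $T_K\mathcal S\cong M(m\times n,\mathbb R)$, define for each $(p,q)\in[m]\times[n]$ $$dY_K(p,q):=\mathbb L\Big(A_{\mathrm{cl}},\;B\,\partial_{(p,q)}Y_KA_{\mathrm{cl}}^\top+A_{\mathrm{cl}}Y_K\,\partial_{(p,q)}^\top B^\top+\partial_{(p,q)}^\top\Sigma_2K+K^\top\Sigma_2\,\partial_{(p,q)}\Big),$$ where $Y_K=\mathbb L(A_{\mathrm{cl}},\Sigma_K)$. Then the Christoffel symbols associated with the metric $g$ in the global coordinate frame $(\partial_{(i,j)})$ satisfy $$\Gamma^{(i,j)}_{(k,\ell)(p,q)}(K)=\begin{cases} \frac12\big[dY_K(p,q)\,Y_K^{-1}\big]_{(\ell,j)}, & k=i\ne p,\\[2pt] \frac12\big[dY_K(k,\ell)\,Y_K^{-1}\big]_{(q,j)}, & p=i\ne k,\\[2pt] -\frac12\sum_s\big[dY_K(i,s)\big]_{(q,\ell)}[Y_K^{-1}]_{(s,j)}, & p=k\ne i,\\[2pt] \frac12\sum_s\Big(\big[dY_K(i,\ell)\big]_{(q,s)}+\big[dY_K(i,q)\big]_{(\ell,s)}-\big[dY_K(i,s)\big]_{(q,\ell)}\Big)[Y_K^{-1}]_{(s,j)}, & p=k=i,\\[2pt] 0,&\text{otherwise.} \end{cases}$$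
   Context: $M(p\times q,\mathbb R)$ is the space of real $p\times q$ matrices, $\rho$ the spectral radius, $[m]=\{1,\dots,m\}$. $(A,B)$ is a stabilizable pair, $A\in M(n\times n,\mathbb R)$, $B\in M(n\times m,\mathbb R)$; $\mathcal S=\{K\in M(m\times n,\mathbb R):\rho(A+BK)<1\}$, an open subset of $M(m\times n,\mathbb R)$; $A_{\mathrm{cl}}=A+BK$. For $\rho(M)<1$, $\mathbb L(M,Z)$ is the unique solution $X$ of $X=MXM^\top+Z$. $\Sigma_1,\Sigma_2\succeq0$ are fixed symmetric matrices and $\Sigma_K=\Sigma_1+K^\top\Sigma_2K$. It is assumed that $(A_{\mathrm{cl}},\Sigma_K^{1/2})$ is controllable for all $K\in\mathcal S$, so that $g_K(V,W)=\mathrm{tr}[V^\top W\,Y_K]$ is a Riemannian metric on $\mathcal S$ (in particular $Y_K\succ0$). The global coordinates on $\mathcal S$ are the matrix entries; the coordinate vector field $\partial_{(i,j)}$ is identified with the $m\times n$ matrix having $1$ in entry $(i,j)$ and $0$ elsewhere. The Christoffel symbols are those of the Levi-Civita connection $\nabla$ of $g$: $\nabla_{\partial_{(k,\ell)}}\partial_{(p,q)}=\sum_{i,j}\Gamma^{(i,j)}_{(k,\ell)(p,q)}\partial_{(i,j)}$. $[M]_{(a,b)}$ is the $(a,b)$ entry of $M$; $s$ ranges over $[n]$. *)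

theory Defs
  imports "HOL-Analysis.Analysis"
begin

definition eigenvalue_cmat :: "complex^'n^'n \<Rightarrow> complex \<Rightarrow> bool" where
  "eigenvalue_cmat M c \<longleftrightarrow> (\<exists>v. v \<noteq> 0 \<and> M *v v = c *s v)"

definition spec_radius :: "real^'n^'n \<Rightarrow> real" where
  "spec_radius M = Max (cmod ` {c. eigenvalue_cmat (map_matrix complex_of_real M) c})"

definition psd :: "real^'n^'n \<Rightarrow> bool" where
  "psd M \<longleftrightarrow> transpose M = M \<and> (\<forall>x. 0 \<le> x \<bullet> (M *v x))"

definition psd_sqrt :: "real^'n^'n \<Rightarrow> real^'n^'n" where
  "psd_sqrt M = (THE R. psd R \<and> R ** R = M)"

text \<open>Kalman's rank condition: the block matrix \<open>[C, A C, \<dots>, A\<^sup>n\<^sup>-\<^sup>1 C]\<close> has rank \<open>n\<close>.\<close>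

definition controllable :: "real^'n^'n \<Rightarrow> real^'r^'n \<Rightarrow> bool" where
  "controllable A C \<longleftrightarrow>
     dim (\<Union>k<CARD('n). columns ((((**) A) ^^ k) C)) = CARD('n)"

definition stabilizing :: "real^'n^'n \<Rightarrow> real^'m^'n \<Rightarrow> (real^'n^'m) set" where
  "stabilizing A B = {K. spec_radius (A + B ** K) < 1}"

definition stabilizable :: "real^'n^'n \<Rightarrow> real^'m^'n \<Rightarrow> bool" where
  "stabilizable A B \<longleftrightarrow> (\<exists>K. spec_radius (A + B ** K) < 1)"

text \<open>The solution exists and is unique when \<open>spec_radius M < 1\<close>.\<close>

definition dlyap :: "real^'n^'n \<Rightarrow> real^'n^'n \<Rightarrow> real^'n^'n" where
  "dlyap M Z = (THE X. X = M ** X ** transpose M + Z)"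

definition Sigma_K :: "real^'n^'n \<Rightarrow> real^'m^'m \<Rightarrow> real^'n^'m \<Rightarrow> real^'n^'n" where
  "Sigma_K \<Sigma>1 \<Sigma>2 K = \<Sigma>1 + transpose K ** \<Sigma>2 ** K"

definition Y_K ::
  "real^'n^'n \<Rightarrow> real^'m^'n \<Rightarrow> real^'n^'n \<Rightarrow> real^'m^'m \<Rightarrow> real^'n^'m \<Rightarrow> real^'n^'n" where
  "Y_K A B \<Sigma>1 \<Sigma>2 K = dlyap (A + B ** K) (Sigma_K \<Sigma>1 \<Sigma>2 K)"

definition lyap_metric ::
  "real^'n^'n \<Rightarrow> real^'m^'n \<Rightarrow> real^'n^'n \<Rightarrow> real^'m^'m \<Rightarrow>
   real^'n^'m \<Rightarrow> real^'n^'m \<Rightarrow> real^'n^'m \<Rightarrow> real" where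
  "lyap_metric A B \<Sigma>1 \<Sigma>2 K V W = trace (transpose V ** W ** Y_K A B \<Sigma>1 \<Sigma>2 K)"

definition coord_mat :: "'m \<times> 'n \<Rightarrow> real^'n^'m" where
  "coord_mat ij = axis (fst ij) (axis (snd ij) 1)"

definition dY_K ::
  "real^'n^'n \<Rightarrow> real^'m^'n \<Rightarrow> real^'n^'n \<Rightarrow> real^'m^'m \<Rightarrow>
   real^'n^'m \<Rightarrow> 'm \<times> 'n \<Rightarrow> real^'n^'n" where
  "dY_K A B \<Sigma>1 \<Sigma>2 K pq =
     (let E = coord_mat pq; Acl = A + B ** K; Y = Y_K A B \<Sigma>1 \<Sigma>2 K
      in dlyap Acl
           (B ** E ** Y ** transpose Acl + Acl ** Y ** transpose E ** transpose B
            + transpose E ** \<Sigma>2 ** K + transpose K ** \<Sigma>2 ** E))"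

text \<open>Meant for open \<open>S\<close>: in finite dimension, being continuously differentiable on an open set
  amounts to being differentiable with all directional derivatives continuous.\<close>

primrec Ck_on ::
  "nat \<Rightarrow> ('a::euclidean_space \<Rightarrow> 'b::euclidean_space) \<Rightarrow> 'a set \<Rightarrow> bool" where
  "Ck_on 0 f S \<longleftrightarrow> continuous_on S f"
| "Ck_on (Suc k) f S \<longleftrightarrow> (\<forall>x\<in>S. f differentiable (at x)) \<and>
     (\<forall>v. Ck_on k (\<lambda>x. frechet_derivative f (at x) v) S)"

definition smooth_on :: "('a::euclidean_space \<Rightarrow> 'b::euclidean_space) \<Rightarrow> 'a set \<Rightarrow> bool" where
  "smooth_on f S \<longleftrightarrow> (\<forall>k. Ck_on k f S)"

text \<open>All tangent spaces of the open set \<open>S\<close> are identified with the ambient space, so a vector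
  field on \<open>S\<close> is a function \<open>'a \<Rightarrow> 'a\<close>, of which only the values on \<open>S\<close> matter.\<close>

definition vf_deriv ::
  "('a::euclidean_space \<Rightarrow> 'a) \<Rightarrow> ('a \<Rightarrow> 'b::euclidean_space) \<Rightarrow> 'a \<Rightarrow> 'b" where
  "vf_deriv X f = (\<lambda>x. frechet_derivative f (at x) (X x))"

definition lie_bracket ::
  "('a::euclidean_space \<Rightarrow> 'a) \<Rightarrow> ('a \<Rightarrow> 'a) \<Rightarrow> 'a \<Rightarrow> 'a" where
  "lie_bracket X Y = (\<lambda>x. vf_deriv X Y x - vf_deriv Y X x)"

text \<open>No separate axiom is needed to say that the connection depends only on the
  restrictions of the two fields to \<open>S\<close>: scaling by the function that is \<open>0\<close> on \<open>S\<close> and \<open>1\<close>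
  elsewhere, which is smooth on \<open>S\<close>, yields it.\<close>

definition affine_connection ::
  "'a::euclidean_space set \<Rightarrow> (('a \<Rightarrow> 'a) \<Rightarrow> ('a \<Rightarrow> 'a) \<Rightarrow> 'a \<Rightarrow> 'a) \<Rightarrow> bool" where
  "affine_connection S conn \<longleftrightarrow>
     (\<forall>X Y. smooth_on X S \<longrightarrow> smooth_on Y S \<longrightarrow> smooth_on (conn X Y) S) \<and>
     (\<forall>X X' Y. smooth_on X S \<longrightarrow> smooth_on X' S \<longrightarrow> smooth_on Y S \<longrightarrow>
        (\<forall>x\<in>S. conn (\<lambda>z. X z + X' z) Y x = conn X Y x + conn X' Y x)) \<and>
     (\<forall>(f::'a \<Rightarrow> real) X Y. smooth_on f S \<longrightarrow> smooth_on X S \<longrightarrow> smooth_on Y S \<longrightarrow>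
        (\<forall>x\<in>S. conn (\<lambda>z. f z *\<^sub>R X z) Y x = f x *\<^sub>R conn X Y x)) \<and>
     (\<forall>X Y Y'. smooth_on X S \<longrightarrow> smooth_on Y S \<longrightarrow> smooth_on Y' S \<longrightarrow>
        (\<forall>x\<in>S. conn X (\<lambda>z. Y z + Y' z) x = conn X Y x + conn X Y' x)) \<and>
     (\<forall>(f::'a \<Rightarrow> real) X Y. smooth_on f S \<longrightarrow> smooth_on X S \<longrightarrow> smooth_on Y S \<longrightarrow>
        (\<forall>x\<in>S. conn X (\<lambda>z. f z *\<^sub>R Y z) x = vf_deriv X f x *\<^sub>R Y x + f x *\<^sub>R conn X Y x))"

definition torsion_free ::
  "'a::euclidean_space set \<Rightarrow> (('a \<Rightarrow> 'a) \<Rightarrow> ('a \<Rightarrow> 'a) \<Rightarrow> 'a \<Rightarrow> 'a) \<Rightarrow> bool" where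
  "torsion_free S conn \<longleftrightarrow>
     (\<forall>X Y. smooth_on X S \<longrightarrow> smooth_on Y S \<longrightarrow>
        (\<forall>x\<in>S. conn X Y x - conn Y X x = lie_bracket X Y x))"

definition metric_compatible ::
  "'a::euclidean_space set \<Rightarrow> ('a \<Rightarrow> 'a \<Rightarrow> 'a \<Rightarrow> real) \<Rightarrow>
   (('a \<Rightarrow> 'a) \<Rightarrow> ('a \<Rightarrow> 'a) \<Rightarrow> 'a \<Rightarrow> 'a) \<Rightarrow> bool" where
  "metric_compatible S g conn \<longleftrightarrow>
     (\<forall>X Y Z. smooth_on X S \<longrightarrow> smooth_on Y S \<longrightarrow> smooth_on Z S \<longrightarrow>
        (\<forall>x\<in>S. vf_deriv X (\<lambda>z. g z (Y z) (Z z)) x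
                 = g x (conn X Y x) (Z x) + g x (Y x) (conn X Z x)))"

definition levi_civita ::
  "'a::euclidean_space set \<Rightarrow> ('a \<Rightarrow> 'a \<Rightarrow> 'a \<Rightarrow> real) \<Rightarrow>
   (('a \<Rightarrow> 'a) \<Rightarrow> ('a \<Rightarrow> 'a) \<Rightarrow> 'a \<Rightarrow> 'a) \<Rightarrow> bool" where
  "levi_civita S g conn \<longleftrightarrow>
     affine_connection S conn \<and> torsion_free S conn \<and> metric_compatible S g conn"

text \<open>\<open>\<Gamma> c a b\<close> is the symbol with upper index \<open>c\<close> and lower indices \<open>a b\<close>.\<close>

definition christoffel_symbols ::
  "(real^'n^'m) set \<Rightarrow>
   ((real^'n^'m \<Rightarrow> real^'n^'m) \<Rightarrow> (real^'n^'m \<Rightarrow> real^'n^'m) \<Rightarrow> real^'n^'m \<Rightarrow> real^'n^'m) \<Rightarrow>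
   ('m \<times> 'n \<Rightarrow> 'm \<times> 'n \<Rightarrow> 'm \<times> 'n \<Rightarrow> real^'n^'m \<Rightarrow> real) \<Rightarrow> bool" where
  "christoffel_symbols S conn \<Gamma> \<longleftrightarrow>
     (\<forall>a b. \<forall>K\<in>S. conn (\<lambda>_. coord_mat a) (\<lambda>_. coord_mat b) K
        = (\<Sum>c\<in>UNIV. \<Gamma> c a b K *\<^sub>R coord_mat c))"

end

(* Along coordinate fields the Koszul formula expresses the Christoffel symbols through the
   directional derivatives of the metric coefficients. The metric has coefficients
   g(d_(k,l), d_(i,s)) = [k = i] Y_(s,l), so only entries of the derivative of Y_K occur, and raising
   the index is multiplication by the inverse of Y_K.

   Differentiating the Lyapunov equation gives a Lyapunov equation for the derivative of Y_K. That
   Y_K is differentiable at K follows from the injectivity of X |-> X - M X M^T at M = A + BK alone,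
   because injectivity persists nearby. Injectivity, symmetry and invertibility of Y_K come from
   M^N -> 0, which is deduced from the bound on the eigenvalues through an annihilating polynomial.
   A vector in the kernel of Y_K is orthogonal to all columns of M^k Sigma_K^(1/2), so it vanishes by
   controllability. *)

theory Submission
  imports Defs "HOL-Computational_Algebra.Fundamental_Theorem_Algebra"
begin

section \<open>Decay of matrix powers\<close>

text \<open>\<open>controllable\<close> iterates left multiplication starting from \<open>C\<close>;
  this isolates the power of \<open>A\<close> as a factor.\<close>

lemma matrix_funpow_mult: "(((**) A) ^^ k) C = (((**) A) ^^ k) (mat 1) ** C"
  for A :: "'a::comm_semiring_1^'n^'n"
  by (induction k) (simp_all add: matrix_mul_assoc)

lemma matrix_funpow_vector: "(((**) A) ^^ k) (mat 1) *v x = (((*v) A) ^^ k) x"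
  for A :: "'a::comm_semiring_1^'n^'n"
  by (induction k) (simp_all flip: matrix_vector_mul_assoc)

text \<open>More than \<open>DIM('a)\<close> vectors are dependent. Since \<open>dependent\<close>
  speaks of sets, a repetition in the sequence has to be treated apart.\<close>

lemma nontrivial_relation:
  fixes u :: "nat \<Rightarrow> 'a::euclidean_space"
  obtains a :: "nat \<Rightarrow> real" and n i where "(\<Sum>i\<le>n. a i *\<^sub>R u i) = 0" "i \<le> n" "a i \<noteq> 0"
proof (cases "inj_on u {..DIM('a)}")
  case True
  then have "card (u ` {..DIM('a)}) = Suc DIM('a)"
    by (simp add: card_image)
  then have "dependent (u ` {..DIM('a)})"
    using independent_bound by fastforce
  then obtain c v where c: "v \<in> u ` {..DIM('a)}" "c v \<noteq> 0"
    "(\<Sum>v\<in>u ` {..DIM('a)}. c v *\<^sub>R v) = 0"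
    by (auto simp: dependent_finite)
  from c(3) True have "(\<Sum>i\<le>DIM('a). c (u i) *\<^sub>R u i) = 0"
    by (simp add: sum.reindex)
  with c(1,2) that[of "\<lambda>i. c (u i)" "DIM('a)"] show ?thesis by auto
next
  case False
  then obtain i j where ij: "i \<le> DIM('a)" "j \<le> DIM('a)" "i \<noteq> j" "u i = u j"
    by (auto simp: inj_on_def)
  \<comment> \<open>The two equal vectors cancel with coefficients 1 and -1.\<close>
  let ?a = "\<lambda>k. (if k = i then 1 else 0) - (if k = j then 1 else (0::real))"
  have "(\<Sum>k\<le>DIM('a). ?a k *\<^sub>R u k) = 0"
    using ij by (simp add: scaleR_left_diff_distrib sum_subtractf if_distrib[of "\<lambda>x. x *\<^sub>R _"] cong: if_cong)
  with ij that[of ?a "DIM('a)" i] show ?thesis by auto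
qed

text \<open>This is p(F)v evaluated by Horner's scheme, so the matrix p(F) itself is never
  formed.\<close>

definition poly_act :: "complex^'n^'n \<Rightarrow> complex poly \<Rightarrow> complex^'n \<Rightarrow> complex^'n" where
  "poly_act F p v = fold_coeffs (\<lambda>a w. a *s v + F *v w) p 0"

lemma poly_act_0 [simp]: "poly_act F 0 v = 0"
  by (simp add: poly_act_def)

lemma poly_act_pCons [simp]: "poly_act F (pCons a p) v = a *s v + F *v poly_act F p v"
  by (cases "a = 0 \<and> p = 0") (auto simp: poly_act_def)

lemma poly_act_add: "poly_act F (p + q) v = poly_act F p v + poly_act F q v"
  by (induction p q rule: poly_induct2)
    (simp_all add: matrix_vector_right_distrib vector_sadd_rdistrib algebra_simps)

lemma poly_act_smult: "poly_act F (smult c p) v = c *s poly_act F p v"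
  by (induction p) (simp_all add: vector_add_ldistrib vector_smult_assoc vector_scalar_commute)

lemma poly_act_monom: "poly_act F (monom c i) v = c *s ((*v) F ^^ i) v"
  by (induction i) (simp_all add: monom_0 monom_Suc vector_scalar_commute)

lemma poly_act_sum: "poly_act F (sum p I) v = (\<Sum>i\<in>I. poly_act F (p i) v)"
  by (induction I rule: infinite_finite_induct) (simp_all add: poly_act_add)

lemma poly_act_linear_factor:
  "poly_act F ([:- c, 1:] * p) v = F *v poly_act F p v - c *s poly_act F p v"
proof -
  have "[:- c, 1:] * p = pCons 0 p + smult (- c) p"
    by simp
  then have "poly_act F ([:- c, 1:] * p) v = F *v poly_act F p v + (- c) *s poly_act F p v"
    by (simp only: poly_act_add poly_act_smult poly_act_pCons) (simp add: vec_eq_iff)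
  then show ?thesis
    by (simp add: vec_eq_iff)
qed

text \<open>p(F) commutes with F - c.\<close>

lemma poly_act_shift:
  "poly_act F p (F *v v - c *s v) = F *v poly_act F p v - c *s poly_act F p v"
proof (induction p)
  case (pCons a p)
  show ?case
    unfolding poly_act_pCons pCons.IH
    by (simp add: matrix_vector_right_distrib matrix_vector_mult_diff_distrib
      vector_scalar_commute vec_eq_iff algebra_simps)
qed simp

text \<open>The complex matrices form a finite-dimensional real space, so the powers of
  \<open>F\<close> satisfy a nontrivial relation, even with real coefficients.\<close>

lemma annihilating_poly:
  fixes F :: "complex^'n^'n"
  obtains p where "p \<noteq> 0" "\<And>v. poly_act F p v = 0"
proof -
  obtain a n i where a: "(\<Sum>i\<le>n. a i *\<^sub>R (((**) F) ^^ i) (mat 1)) = 0" "i \<le> n" "a i \<noteq> 0"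
    by (rule nontrivial_relation[of "\<lambda>i. (((**) F) ^^ i) (mat 1)"])
  let ?p = "\<Sum>i\<le>n. monom (complex_of_real (a i)) i"
  have "coeff ?p i = a i"
    using a(2) by (simp add: coeff_sum)
  then have "?p \<noteq> 0"
    using a(3) by auto
  moreover have "poly_act F ?p v = 0" for v
  proof -
    have *: "complex_of_real r *s (G *v v) = (r *\<^sub>R G) *v v" for r and G :: "complex^'n^'n"
      by (simp only: vec_eq_iff matrix_vector_mult_def vector_smult_component vec_lambda_beta vector_scaleR_component sum_distrib_left mult.assoc)
        (simp add: scaleR_conv_of_real mult.assoc)
    have "poly_act F ?p v = (\<Sum>i\<le>n. (a i *\<^sub>R (((**) F) ^^ i) (mat 1)) *v v)"
      by (simp add: poly_act_sum poly_act_monom flip: matrix_funpow_vector *)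
    also have "\<dots> = (\<Sum>i\<le>n. a i *\<^sub>R (((**) F) ^^ i) (mat 1)) *v v"
      by (induction n) (simp_all add: matrix_vector_mult_add_rdistrib)
    finally show ?thesis
      using a(1) by simp
  qed
  ultimately show ?thesis
    using that by blast
qed

text \<open>On an eigenvector for c, p(F) acts as p(c), so every eigenvalue is a root of an
  annihilating p. Finiteness gives the \<open>Max\<close> in \<open>spec_radius\<close> its
  meaning.\<close>

lemma finite_eigenvalues: "finite {c. eigenvalue_cmat F c}"
proof -
  obtain p where p: "p \<noteq> 0" "\<And>v. poly_act F p v = 0"
    using annihilating_poly by blast
  have "poly p c = 0" if c: "eigenvalue_cmat F c" for c
  proof -
    obtain v where v: "v \<noteq> 0" "F *v v = c *s v"
      using c by (auto simp: eigenvalue_cmat_def)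
    have "poly_act F q v = poly q c *s v" for q
    proof (induction q)
      case (pCons a q)
      show ?case
        unfolding poly_act_pCons pCons.IH vector_scalar_commute v(2)
        by (simp add: vec_eq_iff algebra_simps)
    qed simp
    then show ?thesis
      using p(2)[of v] v(1) by (metis vector_mul_eq_0)
  qed
  then show ?thesis
    by (intro finite_subset[OF _ poly_roots_finite[OF p(1)]]) auto
qed

lemma eigenvalue_less_spec_radius:
  assumes "eigenvalue_cmat (map_matrix complex_of_real M) c"
  shows "cmod c \<le> spec_radius M"
  unfolding spec_radius_def using assms finite_eigenvalues by (intro Max_ge) auto

text \<open>For c = r the recursion can grow like N * r^N, so the new rate has to exceed c
  strictly.\<close>

lemma geometric_bound_step:
  fixes u :: "nat \<Rightarrow> real"
  assumes "\<And>N. u (Suc N) \<le> c * u N + C * r ^ N" "0 \<le> c" "c < 1" "0 \<le> C" "0 \<le> r" "r < 1"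
    and "\<And>N. 0 \<le> u N"
  obtains D s where "0 \<le> s" "s < 1" "0 \<le> D" "\<And>N. u N \<le> D * s ^ N"
proof -
  define s where "s = (max c r + 1) / 2"
  have s: "c < s" "r \<le> s" "0 \<le> s" "s < 1"
    using assms by (auto simp: s_def max_def)
  \<comment> \<open>The first summand starts the induction; the second gives c * D + C \<le> D * s,
    which closes it.\<close>
  define D where "D = u 0 + C / (s - c)"
  have D: "C \<le> D * (s - c)" "0 \<le> D" "u 0 \<le> D"
  proof -
    have "D * (s - c) = u 0 * (s - c) + C"
      using s by (simp add: D_def distrib_right)
    moreover have "0 \<le> u 0 * (s - c)" "0 \<le> C / (s - c)"
      using s assms by simp_all
    ultimately show "C \<le> D * (s - c)" "0 \<le> D" "u 0 \<le> D"
      using assms(7)[of 0] by (simp_all add: D_def)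
  qed
  have "u N \<le> D * s ^ N" for N
  proof (induction N)
    case (Suc N)
    have "u (Suc N) \<le> c * (D * s ^ N) + C * s ^ N"
      using Suc assms(1)[of N] s assms
      by (smt (verit, best) mult_left_mono power_mono)
    also have "\<dots> = (c * D + C) * s ^ N"
      by (simp add: algebra_simps)
    also have "\<dots> \<le> (D * s) * s ^ N"
      using D s by (intro mult_right_mono) (auto simp: algebra_simps)
    finally show ?case by (simp add: algebra_simps)
  qed (use D in simp)
  with that s D show ?thesis by blast
qed

text \<open>Linear factors of the annihilating polynomial are split off one at a time: a factor
  \<open>F - c\<close> with \<open>\<bar>c\<bar> \<ge> 1\<close> is injective and can be cancelled, one with \<open>\<bar>c\<bar> < 1\<close>
  preserves geometric decay of the orbit.\<close>

lemma orbit_geometric_decay: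
  fixes F :: "complex^'n^'n"
  assumes ev: "\<And>c. eigenvalue_cmat F c \<Longrightarrow> cmod c < 1"
    and "p \<noteq> 0" "poly_act F p v = 0"
  shows "\<exists>C r. 0 \<le> C \<and> 0 \<le> r \<and> r < 1 \<and> (\<forall>N. norm (((*v) F ^^ N) v) \<le> C * r ^ N)"
  using assms(2,3)
proof (induction "degree p" arbitrary: p v)
  case 0
  then obtain a where "p = [:a:]" "a \<noteq> 0"
    by (metis degree_eq_zeroE pCons_0_0)
  with 0 have "v = 0"
    by simp
  then have "((*v) F ^^ N) v = 0" for N
    by (induction N) auto
  then show ?case
    by (intro exI[of _ 0]) auto
next
  case (Suc d)
  have "\<not> constant (poly p)"
    using Suc.hyps(2) by (simp add: constant_degree)
  then obtain c where "poly p c = 0"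
    using fundamental_theorem_of_algebra by blast
  then obtain q where q: "p = [:- c, 1:] * q"
    by (auto simp: poly_eq_0_iff_dvd elim: dvdE)
  have "q \<noteq> 0"
    using q Suc.prems by auto
  have deg: "d = degree q"
    using Suc.hyps(2) \<open>q \<noteq> 0\<close> unfolding q by (subst (asm) degree_mult_eq) auto
  \<comment> \<open>q(F)v lies in the kernel of F - c: it vanishes unless c is an
    eigenvalue.\<close>
  have 0: "F *v poly_act F q v - c *s poly_act F q v = 0"
    using Suc.prems(2) unfolding q poly_act_linear_factor .
  show ?case
  proof (cases "cmod c < 1")
    case False
    then have "poly_act F q v = 0"
      using ev[of c] 0 by (auto simp: eigenvalue_cmat_def)
    then show ?thesis
      using Suc.hyps(1)[OF deg \<open>q \<noteq> 0\<close>] by blast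
  next
    case True
    \<comment> \<open>Since q(F) commutes with F - c, it kills w, so the induction hypothesis
      applies to w. The orbit of v then obeys a first-order recursion driven by that of w.\<close>
    define w where "w = F *v v - c *s v"
    have "poly_act F q w = 0"
      unfolding w_def poly_act_shift by (rule 0)
    then obtain C r where Cr: "0 \<le> C" "0 \<le> r" "r < 1" "\<And>N. norm (((*v) F ^^ N) w) \<le> C * r ^ N"
      using Suc.hyps(1)[OF deg \<open>q \<noteq> 0\<close>] by blast
    have step: "((*v) F ^^ Suc N) v = c *s ((*v) F ^^ N) v + ((*v) F ^^ N) w" for N
      by (induction N) (simp_all add: w_def matrix_vector_right_distrib vector_scalar_commute)
    have norm_s: "norm (c *s x) = cmod c * norm x" for x :: "complex^'n"
      by (simp add: norm_vec_def norm_mult L2_set_right_distrib)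
    have "norm (((*v) F ^^ Suc N) v) \<le> cmod c * norm (((*v) F ^^ N) v) + C * r ^ N" for N
      unfolding step using norm_triangle_ineq Cr(4)[of N] norm_s by (smt (verit))
    then show ?thesis
      by (rule geometric_bound_step) (use True Cr in auto)
  qed
qed

text \<open>Column j of the N-th power is the orbit of the j-th basis vector. Passing to complex
  vectors, where \<open>orbit_geometric_decay\<close> applies, changes no entry.\<close>

lemma funpow_tendsto_0:
  fixes M :: "real^'n^'n"
  assumes "spec_radius M < 1"
  shows "(\<lambda>N. (((**) M) ^^ N) (mat 1)) \<longlonglongrightarrow> 0"
proof -
  let ?F = "map_matrix complex_of_real M"
  have "(\<lambda>N. ((((**) M) ^^ N) (mat 1)) $ i $ j) \<longlonglongrightarrow> 0" for i j
  proof -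
    let ?e = "axis j 1 :: real^'n" and ?c = "\<lambda>x. \<chi> i. complex_of_real (x $ i)"
    obtain p where "p \<noteq> 0" "\<And>v. poly_act ?F p v = 0"
      using annihilating_poly by blast
    then obtain C r where Cr: "0 \<le> r" "r < 1" "\<And>N. norm (((*v) ?F ^^ N) (?c ?e)) \<le> C * r ^ N"
      using orbit_geometric_decay eigenvalue_less_spec_radius assms by (smt (verit))
    have eq: "((*v) ?F ^^ N) (?c x) = ?c (((*v) M ^^ N) x)" for N and x :: "real^'n"
      by (induction N) (simp_all add: vec_eq_iff matrix_vector_mult_def map_matrix_def)
    have "((((**) M) ^^ N) (mat 1)) $ i $ j = (((*v) M ^^ N) ?e) $ i" for N
      by (simp add: matrix_vector_mul_component inner_axis flip: matrix_funpow_vector)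
    then have "norm (((((**) M) ^^ N) (mat 1)) $ i $ j) = norm ((((*v) ?F ^^ N) (?c ?e)) $ i)" for N
      by (simp add: eq)
    then have le: "norm (((((**) M) ^^ N) (mat 1)) $ i $ j) \<le> C * r ^ N" for N
      using order_trans[OF Finite_Cartesian_Product.norm_nth_le Cr(3)] by simp
    have "(\<lambda>N. C * r ^ N) \<longlonglongrightarrow> 0"
      using Cr by (intro tendsto_mult_right_zero LIMSEQ_power_zero) auto
    then show ?thesis
      by (rule Lim_null_comparison[OF always_eventually[OF allI[OF le]]])
  qed
  then show ?thesis
    by (intro vec_tendstoI) auto
qed

section \<open>The discrete Lyapunov equation\<close>

lemma matrix_add_rdistrib: "(X + Y) ** Z = X ** Z + Y ** Z"
  for X Y :: "real^'n^'m" and Z :: "real^'p^'n"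
  by (simp add: matrix_matrix_mult_def vec_eq_iff distrib_right sum.distrib)

lemma bounded_bilinear_matrix_mult:
  "bounded_bilinear ((**) :: real^'n^'m \<Rightarrow> real^'p^'n \<Rightarrow> real^'p^'m)"
  by (subst bilinear_conv_bounded_bilinear [symmetric])
    (auto simp: bilinear_def matrix_add_ldistrib matrix_add_rdistrib scalar_matrix_assoc
      matrix_scalar_ac intro!: linearI)

lemma bounded_linear_transpose: "bounded_linear (transpose :: real^'n^'m \<Rightarrow> real^'m^'n)"
  by (subst linear_conv_bounded_linear [symmetric])
    (auto simp: transpose_def vec_eq_iff intro!: linearI)

lemma bounded_linear_matrix_vector_left: "bounded_linear (\<lambda>P. P *v x)" for x :: "real^'n"
  by (subst linear_conv_bounded_linear [symmetric], rule linearI)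
    (simp_all add: matrix_vector_mult_add_rdistrib scaleR_matrix_vector_assoc)

lemmas tendsto_matrix_mult = bounded_bilinear.tendsto[OF bounded_bilinear_matrix_mult]
lemmas has_derivative_matrix_mult = bounded_bilinear.FDERIV[OF bounded_bilinear_matrix_mult]
lemmas tendsto_transpose = bounded_linear.tendsto[OF bounded_linear_transpose]
lemmas has_derivative_transpose = bounded_linear.has_derivative[OF bounded_linear_transpose]

lemma transpose_plus: "transpose (X + Y) = transpose X + transpose Y" for X Y :: "real^'n^'m"
  by (simp add: transpose_def vec_eq_iff)

lemma transpose_0: "transpose 0 = (0 :: real^'n^'m)"
  by (simp add: transpose_def vec_eq_iff)

lemma dot_matrix_vector: "(P *v x) \<bullet> y = x \<bullet> (transpose P *v y)" for P :: "real^'n^'m"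
  by (metis dot_lmul_matrix inner_commute transpose_matrix_vector)

section \<open>The Lyapunov operator and its inverse\<close>

lemma linear_lyapunov_op: "linear (\<lambda>X. X - M ** X ** transpose M)" for M :: "real^'n^'n"
  by (rule linearI)
    (simp_all add: matrix_add_ldistrib matrix_add_rdistrib matrix_scalar_ac
      scaleR_right_diff_distrib flip: scalar_matrix_assoc)

text \<open>Iterating X = M X M^T gives X = M^N X (M^N)^T, which tends to 0.\<close>

lemma inj_lyapunov_op:
  fixes M :: "real^'n^'n"
  assumes M: "spec_radius M < 1"
  shows "inj (\<lambda>X. X - M ** X ** transpose M)"
  unfolding linear_injective_0[OF linear_lyapunov_op]
proof (intro allI impI)
  fix X assume "X - M ** X ** transpose M = 0"
  then have X: "X = M ** X ** transpose M"
    by simp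
  let ?P = "\<lambda>N. (((**) M) ^^ N) (mat 1)"
  have "X = ?P N ** X ** transpose (?P N)" for N
  proof (induction N)
    case (Suc N)
    have "?P (Suc N) ** X ** transpose (?P (Suc N)) = M ** (?P N ** X ** transpose (?P N)) ** transpose M"
      by (simp add: matrix_transpose_mul matrix_mul_assoc)
    with Suc X show ?case by simp
  qed simp
  moreover have "(\<lambda>N. ?P N ** X ** transpose (?P N)) \<longlonglongrightarrow> 0 ** X ** transpose 0"
    by (intro tendsto_matrix_mult tendsto_transpose tendsto_const funpow_tendsto_0 M)
  ultimately have "(\<lambda>N. X) \<longlonglongrightarrow> 0 ** X ** transpose 0"
    by simp
  then show "X = 0"
    by (simp add: LIMSEQ_const_iff transpose_0)
qed

text \<open>An injective endomorphism of a finite-dimensional space is bijective. Assuming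
  injectivity instead of a spectral bound lets the lemma apply at perturbed matrices too.\<close>

lemma dlyap_unique:
  fixes M :: "real^'n^'n"
  assumes inj: "inj (\<lambda>X. X - M ** X ** transpose M)"
  shows "X = M ** X ** transpose M + Z \<longleftrightarrow> X = dlyap M Z"
proof -
  let ?L = "\<lambda>X. X - M ** X ** transpose M"
  have "surj ?L"
    using linear_inj_imp_surj[OF linear_lyapunov_op inj] .
  then obtain W where "Z = ?L W"
    by (rule surjE)
  with inj have "\<exists>!X. ?L X = Z"
    by (auto dest: injD)
  then have ex: "\<exists>!X. X = M ** X ** transpose M + Z"
    by (simp add: diff_eq_eq add.commute)
  show ?thesis
    unfolding dlyap_def using theI'[OF ex] the1_equality[OF ex] by blast
qed

text \<open>The transpose of the solution solves the same equation.\<close>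

lemma transpose_dlyap:
  assumes inj: "inj (\<lambda>X. X - M ** X ** transpose M)" and "transpose Z = Z"
  shows "transpose (dlyap M Z) = dlyap M Z"
proof -
  have "dlyap M Z = M ** dlyap M Z ** transpose M + Z"
    using dlyap_unique[OF inj] by blast
  then have "transpose (dlyap M Z) = transpose (M ** dlyap M Z ** transpose M + Z)"
    by (rule arg_cong)
  then have "transpose (dlyap M Z) = M ** transpose (dlyap M Z) ** transpose M + Z"
    using assms(2) by (simp add: transpose_plus matrix_transpose_mul matrix_mul_assoc)
  then show ?thesis
    using dlyap_unique[OF inj] by blast
qed

lemma linear_dlyap:
  assumes inj: "inj (\<lambda>X. X - M ** X ** transpose M)"
  shows "linear (dlyap M)"
proof -
  let ?T = "\<lambda>X. M ** X ** transpose M"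
  note u = dlyap_unique[OF inj]
  have eq: "dlyap M Z = ?T (dlyap M Z) + Z" for Z
    using u by blast
  show ?thesis
  proof (rule linearI)
    fix X Y r
    have "dlyap M X + dlyap M Y = (?T (dlyap M X) + X) + (?T (dlyap M Y) + Y)"
      by (rule arg_cong2[OF eq eq])
    also have "\<dots> = ?T (dlyap M X + dlyap M Y) + (X + Y)"
      by (simp add: matrix_add_ldistrib matrix_add_rdistrib)
    finally show "dlyap M (X + Y) = dlyap M X + dlyap M Y"
      using u by metis
    have "r *\<^sub>R dlyap M X = r *\<^sub>R (?T (dlyap M X) + X)"
      by (rule arg_cong[OF eq])
    also have "\<dots> = ?T (r *\<^sub>R dlyap M X) + r *\<^sub>R X"
      by (simp add: matrix_scalar_ac scaleR_right_distrib flip: scalar_matrix_assoc)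
    finally show "dlyap M (r *\<^sub>R X) = r *\<^sub>R dlyap M X"
      using u by metis
  qed
qed

text \<open>Unfolding the equation \<open>N\<close> times writes the quadratic form of the solution as a sum of
  values of the nonnegative form of \<open>Z\<close> along the orbit, up to a remainder that tends to \<open>0\<close>.\<close>

lemma dlyap_kernel:
  fixes M Z :: "real^'n^'n"
  assumes M: "spec_radius M < 1" and Z: "psd Z" and x: "dlyap M Z *v x = 0"
  shows "(transpose ((((**) M) ^^ k) (mat 1)) *v x) \<bullet> (Z *v (transpose ((((**) M) ^^ k) (mat 1)) *v x)) = 0"
proof -
  let ?P = "\<lambda>N. (((**) M) ^^ N) (mat 1)"
  define Y where "Y = dlyap M Z"
  define q where "q N = (transpose (?P N) *v x) \<bullet> (Z *v (transpose (?P N) *v x))" for N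
  define r where "r N = x \<bullet> ((?P N ** Y ** transpose (?P N)) *v x)" for N
  have Y: "Y = M ** Y ** transpose M + Z"
    unfolding Y_def using dlyap_unique[OF inj_lyapunov_op[OF M]] by blast
  \<comment> \<open>Substituting the equation between the powers puts the new factor
    \<open>M\<close> on the right of \<open>?P N\<close>, while \<open>funpow\<close> puts it on the
    left.\<close>
  have Pswap: "?P N ** M = M ** ?P N" for N
    by (induction N) (simp_all flip: matrix_mul_assoc)
  have q: "q N = x \<bullet> ((?P N ** Z ** transpose (?P N)) *v x)" for N
    by (simp add: q_def dot_matrix_vector del: transpose_matrix_vector flip: matrix_vector_mul_assoc)
  have step: "r N = r (Suc N) + q N" for N
  proof -
    have "?P N ** Y ** transpose (?P N)
        = ?P N ** (M ** Y ** transpose M + Z) ** transpose (?P N)"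
      using Y by simp
    also have "\<dots> = ?P (Suc N) ** Y ** transpose (?P (Suc N)) + ?P N ** Z ** transpose (?P N)"
      by (simp add: matrix_add_ldistrib matrix_add_rdistrib matrix_transpose_mul matrix_mul_assoc
          flip: Pswap)
    finally show ?thesis
      by (simp add: r_def q matrix_vector_mult_add_rdistrib inner_add_right)
  qed
  \<comment> \<open>This is where \<open>x\<close> lying in the kernel enters. The partial sums of q
    telescope to - r N, so nonnegative terms sum to 0 and each of them vanishes.\<close>
  have "r 0 = 0"
    using x by (simp add: r_def Y_def)
  then have sum: "(\<Sum>n<N. q n) = - r N" for N
  proof (induction N)
    case (Suc N)
    then show ?case
      using step[of N] by simp
  qed simp
  have "r \<longlonglongrightarrow> x \<bullet> ((0 ** Y ** transpose 0) *v x)"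
    unfolding r_def
    by (intro tendsto_intros bounded_linear.tendsto[OF bounded_linear_matrix_vector_left]
        tendsto_matrix_mult tendsto_transpose funpow_tendsto_0 M)
  then have "(\<lambda>N. \<Sum>n<N. q n) \<longlonglongrightarrow> 0"
    unfolding sum using tendsto_minus by fastforce
  then have "q sums 0"
    by (simp add: sums_def)
  moreover have "0 \<le> q n" for n
    using Z by (simp add: psd_def q_def)
  ultimately have "q k = 0"
    by (metis suminf_eq_zero_iff sums_iff)
  then show ?thesis
    by (simp add: q_def)
qed

section \<open>Positive semidefinite square roots and controllability\<close>

lemma symmetric_dot: "transpose M = M \<Longrightarrow> (M *v x) \<bullet> y = x \<bullet> (M *v y)" for M :: "real^'n^'n"
  by (metis dot_matrix_vector)

text \<open>If a were nonzero, the linear term would dominate for small t of sign opposite to a; t =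
  - a / d with b < 2 * d is small enough.\<close>

lemma nonneg_quadratic_imp_linear_coeff_0:
  fixes a b :: real
  assumes "\<And>t. 0 \<le> 2 * t * a + t * t * b"
  shows "a = 0"
proof (rule ccontr)
  assume "a \<noteq> 0"
  define d where "d = \<bar>b\<bar> + 1"
  have "0 < d" "b < 2 * d"
    by (auto simp: d_def)
  have "0 \<le> (2 * (- a / d) * a + (- a / d) * (- a / d) * b) * (d * d)"
    using assms[of "- a / d"] \<open>0 < d\<close> by (intro mult_nonneg_nonneg) auto
  also have "\<dots> = a * a * (b - 2 * d)"
    using \<open>0 < d\<close> by (simp add: field_simps)
  also have "\<dots> < 0"
    using \<open>a \<noteq> 0\<close> \<open>b < 2 * d\<close> by (intro mult_pos_neg) (auto simp flip: power2_eq_square)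
  finally show False by simp
qed

text \<open>x minimises the form on S, so its first variation in the direction \<open>N *v x\<close>
  vanishes; that variation is twice the squared norm of \<open>N *v x\<close>.\<close>

lemma nonneg_form_zero:
  fixes N :: "real^'n^'n"
  assumes sym: "transpose N = N" and S: "subspace S" and nonneg: "\<And>y. y \<in> S \<Longrightarrow> 0 \<le> y \<bullet> (N *v y)"
    and x: "x \<in> S" "N *v x \<in> S" "x \<bullet> (N *v x) = 0"
  shows "N *v x = 0"
proof -
  let ?w = "N *v x"
  have "0 \<le> 2 * t * (?w \<bullet> ?w) + t * t * (?w \<bullet> (N *v ?w))" for t
  proof -
    have "0 \<le> (x + t *\<^sub>R ?w) \<bullet> (N *v (x + t *\<^sub>R ?w))"
      using x S by (intro nonneg) (simp add: subspace_add subspace_scale)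
    also have "\<dots> = 2 * t * (?w \<bullet> ?w) + t * t * (?w \<bullet> (N *v ?w))"
      using x(3) symmetric_dot[OF sym, of x ?w]
      by (simp add: algebra_simps matrix_vector_mult_scaleR)
    finally show ?thesis .
  qed
  then show ?thesis
    using nonneg_quadratic_imp_linear_coeff_0 by (metis inner_eq_zero_iff)
qed

text \<open>At a maximiser of the quadratic form on the unit sphere of the subspace, with maximum \<open>c\<close>,
  the nonnegative form \<open>c - M\<close> vanishes.\<close>

lemma symmetric_eigenvector_in_subspace:
  fixes M :: "real^'n^'n"
  assumes sym: "transpose M = M" and S: "subspace S" "S \<noteq> {0}"
    and inv: "\<And>x. x \<in> S \<Longrightarrow> M *v x \<in> S"
  obtains x c where "x \<in> S" "norm x = 1" "M *v x = c *\<^sub>R x"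
proof -
  have "compact (S \<inter> sphere 0 1)"
    using S(1) closed_subspace closed_Int_compact compact_sphere by blast
  moreover have "S \<inter> sphere 0 1 \<noteq> {}"
  proof -
    obtain y where "y \<in> S" "y \<noteq> 0"
      using S subspace_0 by blast
    then have "(1 / norm y) *\<^sub>R y \<in> S \<inter> sphere 0 1"
      using S(1) by (simp add: subspace_scale)
    then show ?thesis by blast
  qed
  moreover have "continuous_on (S \<inter> sphere 0 1) (\<lambda>x. x \<bullet> (M *v x))"
    by (intro continuous_intros linear_continuous_on matrix_vector_mul_bounded_linear)
  ultimately have "\<exists>x\<in>S \<inter> sphere 0 1. \<forall>y\<in>S \<inter> sphere 0 1. y \<bullet> (M *v y) \<le> x \<bullet> (M *v x)"
    by (rule continuous_attains_sup)
  then obtain x where x: "x \<in> S" "norm x = 1"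
    and max: "\<And>y. y \<in> S \<Longrightarrow> norm y = 1 \<Longrightarrow> y \<bullet> (M *v y) \<le> x \<bullet> (M *v x)"
    by auto
  define c where "c = x \<bullet> (M *v x)"
  let ?N = "c *\<^sub>R mat 1 - M"
  have N: "?N *v y = c *\<^sub>R y - M *v y" for y
    by (simp add: matrix_vector_mult_diff_rdistrib flip: scaleR_matrix_vector_assoc)
  have "?N *v x = 0"
  proof (rule nonneg_form_zero[OF _ S(1) _ x(1)])
    show "transpose ?N = ?N"
      using sym by (simp add: transpose_def vec_eq_iff mat_def)
    show "?N *v x \<in> S"
      unfolding N using x(1) S(1) inv by (simp add: subspace_diff subspace_scale)
    show "x \<bullet> (?N *v x) = 0"
      unfolding N using x(2) by (simp add: inner_diff_right c_def norm_eq_1)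
    show "0 \<le> y \<bullet> (?N *v y)" if "y \<in> S" for y
    proof (cases "y = 0")
      case False
      then have "((1 / norm y) *\<^sub>R y) \<bullet> (M *v ((1 / norm y) *\<^sub>R y)) \<le> c"
        unfolding c_def using that S(1) by (intro max) (simp_all add: subspace_scale)
      then have "y \<bullet> (M *v y) \<le> c * (norm y)\<^sup>2"
        using False by (simp add: matrix_vector_mult_scaleR field_simps power2_eq_square)
      then show ?thesis
        unfolding N by (simp add: inner_diff_right power2_norm_eq_inner)
    qed simp
  qed
  then show ?thesis
    using that[of x c] x by (simp add: N)
qed

text \<open>An orthonormal set of eigenvectors of largest cardinality spans: otherwise its
  orthogonal complement is a nonzero invariant subspace and contains a further unit
  eigenvector.\<close>

lemma symmetric_orthonormal_eigenbasis:
  fixes M :: "real^'n^'n"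
  assumes sym: "transpose M = M"
  obtains E where "finite E" "pairwise orthogonal E" "\<And>e. e \<in> E \<Longrightarrow> norm e = 1"
    "\<And>e. e \<in> E \<Longrightarrow> M *v e = (e \<bullet> (M *v e)) *\<^sub>R e" "span E = UNIV"
proof -
  define P where "P E \<longleftrightarrow> pairwise orthogonal E \<and>
    (\<forall>e\<in>E. norm e = 1 \<and> M *v e = (e \<bullet> (M *v e)) *\<^sub>R e)" for E
  have indep: "finite E \<and> card E \<le> CARD('n)" if "P E" for E
  proof -
    have "independent E"
      using that by (intro pairwise_orthogonal_independent) (auto simp: P_def)
    then show ?thesis
      using independent_bound by fastforce
  qed
  have "P {}"
    by (simp add: P_def)
  then have "\<exists>E. P E \<and> (\<forall>E'. P E' \<longrightarrow> card E' \<le> card E)"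
    \<comment> \<open>Orthonormal sets are independent, so their cardinality is bounded and a
      largest one exists.\<close>
    using indep by (intro ex_has_greatest_nat[of P "{}" card "Suc CARD('n)"]) (auto simp: less_Suc_eq_le)
  then obtain E where E: "P E" and max: "\<And>E'. P E' \<Longrightarrow> card E' \<le> card E"
    by blast
  have "span E = UNIV"
  proof (rule ccontr)
    assume "span E \<noteq> UNIV"
    define S where "S = {x. \<forall>e\<in>E. orthogonal e x}"
    have S: "subspace S"
      unfolding S_def by (rule subspace_orthogonal_to_vectors)
    obtain a where "a \<noteq> 0" "\<And>x. x \<in> span E \<Longrightarrow> a \<bullet> x = 0"
      using span_not_univ_subset_hyperplane[OF \<open>span E \<noteq> UNIV\<close>] by auto
    then have "a \<in> S" "a \<noteq> 0"
      by (auto simp: S_def orthogonal_def span_base inner_commute)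
    moreover have "M *v x \<in> S" if "x \<in> S" for x
    proof -
      have "e \<bullet> (M *v x) = 0" if "e \<in> E" for e
      proof -
        have "e \<bullet> (M *v x) = (M *v e) \<bullet> x"
          using symmetric_dot[OF sym] by simp
        also have "\<dots> = (e \<bullet> (M *v e)) * (e \<bullet> x)"
          using E that unfolding P_def by (metis inner_scaleR_left)
        finally show ?thesis
          using that \<open>x \<in> S\<close> by (simp add: S_def orthogonal_def)
      qed
      then show ?thesis
        by (simp add: S_def orthogonal_def)
    qed
    ultimately obtain x c where x: "x \<in> S" "norm x = 1" "M *v x = c *\<^sub>R x"
      using symmetric_eigenvector_in_subspace[OF sym S] by blast
    then have "c = x \<bullet> (M *v x)"
      by (simp add: norm_eq_1)
    then have "P (insert x E)"
      using E x by (auto simp: P_def S_def pairwise_insert orthogonal_commute)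
    moreover have "x \<notin> E"
      using x by (auto simp: S_def orthogonal_def)
    ultimately show False
      using max[of "insert x E"] indep[OF E] by simp
  qed
  with that[of E] E indep[OF E] show ?thesis
    by (auto simp: P_def)
qed

lemma matrix_eq_on_spanning:
  fixes P Q :: "real^'n^'n"
  assumes "span E = UNIV" "\<And>e. e \<in> E \<Longrightarrow> P *v e = Q *v e"
  shows "P = Q"
proof -
  have "(*v) P = (*v) Q"
    by (rule linear_eq_on_span[of _ _ E, THEN ext]) (use assms in \<open>auto intro: matrix_vector_mul_linear\<close>)
  then show ?thesis
    by (metis matrix_eq)
qed

text \<open>For w = (R - s)e the hypothesis says (R + s)w = 0, so nonnegativity of R forces w = 0
  when s > 0. For s = 0 the squared norm of Re is the form of R^2 at e, which is 0.\<close>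

lemma psd_sqrt_eigenvector:
  fixes R :: "real^'n^'n"
  assumes R: "psd R" and e: "(R ** R) *v e = (s * s) *\<^sub>R e" and s: "0 \<le> s"
  shows "R *v e = s *\<^sub>R e"
proof -
  let ?w = "R *v e - s *\<^sub>R e"
  have Rw: "R *v ?w = - s *\<^sub>R ?w"
    using e by (simp add: matrix_vector_mult_diff_distrib matrix_vector_mult_scaleR
        matrix_vector_mul_assoc algebra_simps)
  have "0 \<le> ?w \<bullet> (R *v ?w)"
    using R by (simp only: psd_def)
  then have "0 \<le> - (s * (?w \<bullet> ?w))"
    unfolding Rw by simp
  then have "s = 0 \<or> ?w = 0"
    using s by (metis inner_eq_zero_iff inner_ge_zero mult_eq_0_iff mult_nonneg_nonneg neg_0_le_iff_le order_antisym)
  moreover have "?w = 0" if "s = 0"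
  proof -
    have "(R *v e) \<bullet> (R *v e) = e \<bullet> ((R ** R) *v e)"
      using R symmetric_dot[of R e "R *v e"] by (simp add: psd_def matrix_vector_mul_assoc)
    then show ?thesis
      using e that by simp
  qed
  ultimately show ?thesis
    by auto
qed

text \<open>\<open>psd_sqrt\<close> is a definite description, so both existence and uniqueness are
  required; an eigenbasis of M provides both.\<close>

lemma psd_sqrt:
  fixes M :: "real^'n^'n"
  assumes M: "psd M"
  shows "psd (psd_sqrt M)" "psd_sqrt M ** psd_sqrt M = M"
proof -
  obtain E where E: "finite E" "pairwise orthogonal E" "\<And>e. e \<in> E \<Longrightarrow> norm e = 1"
    "\<And>e. e \<in> E \<Longrightarrow> M *v e = (e \<bullet> (M *v e)) *\<^sub>R e" "span E = UNIV"
    using symmetric_orthonormal_eigenbasis M unfolding psd_def by metis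
  define s where "s e = sqrt (e \<bullet> (M *v e))" for e
  have s: "0 \<le> s e" "s e * s e = e \<bullet> (M *v e)" for e
    using M by (auto simp: s_def psd_def)
  \<comment> \<open>The spectral formula for the root: f scales each basis vector e by
    \<open>s e\<close>.\<close>
  define f where "f x = (\<Sum>e\<in>E. (s e * (e \<bullet> x)) *\<^sub>R e)" for x
  have "linear f"
    unfolding f_def
    by (intro linearI) (simp_all add: inner_add_right distrib_left scaleR_left_distrib
        sum.distrib scaleR_sum_right mult.left_commute)
  define R where "R = matrix f"
  have R: "R *v x = f x" for x
    unfolding R_def by (rule fun_cong[OF matrix_vector_mul(2)[OF \<open>linear f\<close>]])
  have Re: "R *v e = s e *\<^sub>R e" if "e \<in> E" for e
  proof -
    have "f e = (\<Sum>e'\<in>E. if e' = e then s e *\<^sub>R e else 0)"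
      unfolding f_def using E(2,3) that
      by (intro sum.cong) (auto simp: pairwise_def orthogonal_def norm_eq_1)
    then show ?thesis
      using that E(1) by (simp add: R)
  qed
  have "R ** R = M"
  proof (rule matrix_eq_on_spanning[OF E(5)])
    fix e assume "e \<in> E"
    have "(R ** R) *v e = (s e * s e) *\<^sub>R e"
      using Re[OF \<open>e \<in> E\<close>] by (simp add: matrix_vector_mult_scaleR flip: matrix_vector_mul_assoc)
    also have "\<dots> = M *v e"
      using E(4)[OF \<open>e \<in> E\<close>] s(2) by simp
    finally show "(R ** R) *v e = M *v e" .
  qed
  moreover have "psd R"
    unfolding psd_def
  proof
    have "(R *v x) \<bullet> y = x \<bullet> (R *v y)" for x y
      by (simp add: R f_def inner_sum_left inner_sum_right inner_commute mult_ac)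
    then have "x \<bullet> (transpose R *v y) = x \<bullet> (R *v y)" for x y
      by (metis dot_matrix_vector)
    then show "transpose R = R"
      by (metis matrix_eq vector_eq_ldot)
    have "x \<bullet> (R *v x) = (\<Sum>e\<in>E. s e * (e \<bullet> x)\<^sup>2)" for x
      by (simp add: R f_def inner_sum_right inner_commute power2_eq_square mult.assoc)
    then show "\<forall>x. 0 \<le> x \<bullet> (R *v x)"
      using s(1) by (simp add: sum_nonneg)
  qed
  \<comment> \<open>Any root acts on each basis vector e as multiplication by \<open>s e\<close>,
    hence agrees with R on a spanning set.\<close>
  moreover have "R' = R" if R': "psd R'" "R' ** R' = M" for R'
  proof (rule matrix_eq_on_spanning[OF E(5)])
    fix e assume "e \<in> E"
    have "(R' ** R') *v e = (s e * s e) *\<^sub>R e"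
      using R'(2) E(4)[OF \<open>e \<in> E\<close>] s(2) by simp
    then show "R' *v e = R *v e"
      using psd_sqrt_eigenvector[OF R'(1)] s(1) Re[OF \<open>e \<in> E\<close>] by metis
  qed
  ultimately have "\<exists>!R. psd R \<and> R ** R = M"
    by blast
  from theI'[OF this] show "psd (psd_sqrt M)" "psd_sqrt M ** psd_sqrt M = M"
    by (simp_all add: psd_sqrt_def)
qed

lemma invertible_dlyap:
  fixes M Z :: "real^'n^'n"
  assumes M: "spec_radius M < 1" and Z: "psd Z" and ctrb: "controllable M (psd_sqrt Z)"
  shows "invertible (dlyap M Z)"
proof -
  define R where "R = psd_sqrt Z"
  have R: "transpose R = R" "R ** R = Z"
    using psd_sqrt[OF Z] by (auto simp: R_def psd_def)
  have "x = 0" if x: "dlyap M Z *v x = 0" for x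
  proof -
    let ?P = "\<lambda>k. (((**) M) ^^ k) (mat 1)"
    have orth: "orthogonal x y" if y: "y \<in> columns ((((**) M) ^^ k) R)" for y k
    proof -
      define z where "z = transpose (?P k) *v x"
      \<comment> \<open>The form of Z at z is the squared norm of Rz, so its vanishing gives Rz =
        0.\<close>
      have "(R *v z) \<bullet> (R *v z) = z \<bullet> (Z *v z)"
        using symmetric_dot[OF R(1), of z "R *v z"] R(2) by (simp add: matrix_vector_mul_assoc)
      then have "R *v z = 0"
        using dlyap_kernel[OF M Z x] by (simp add: z_def del: transpose_matrix_vector)
      obtain i where "y = column i (?P k ** R)"
        using y matrix_funpow_mult[of k M R] by (auto simp: columns_def)
      then have "y = ?P k *v (R *v axis i 1)"
        by (simp only: matrix_vector_mul_assoc flip: matrix_vector_mult_basis)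
      then have "y \<bullet> x = axis i 1 \<bullet> (R *v z)"
        unfolding z_def by (metis dot_matrix_vector R(1))
      then show ?thesis
        using \<open>R *v z = 0\<close> by (simp add: orthogonal_def inner_commute)
    qed
    \<comment> \<open>Kalman's condition makes these columns span, so x is orthogonal to
      itself.\<close>
    have "span (\<Union>k<CARD('n). columns ((((**) M) ^^ k) R)) = UNIV"
      using ctrb by (simp add: controllable_def R_def flip: dim_eq_full)
    then have "orthogonal x x"
      using orthogonal_to_span[of x _ x] orth by blast
    then show "x = 0"
      by (simp add: orthogonal_self)
  qed
  then show ?thesis
    by (simp add: invertible_left_inverse matrix_left_invertible_ker)
qed

section \<open>Differentiating the Lyapunov solution\<close>

lemma has_derivative_linear_solution:
  fixes L :: "'a::real_normed_vector \<Rightarrow> 'b::real_normed_vector \<Rightarrow> 'c::real_normed_vector"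
  assumes lin: "\<And>z. linear (L z)"
    and c: "0 < c" "\<And>X. c * norm X \<le> norm (L a X)"
    and e: "(e \<longlongrightarrow> 0) (at a)" "\<And>z X. norm (L z X - L a X) \<le> e z * norm X"
    and sol: "\<forall>\<^sub>F z in at a. L z (Y z) = S z" "L a (Y a) = S a"
    and h: "((\<lambda>z. S z - L z (Y a)) has_derivative h') (at a)"
    and D: "bounded_linear D" "\<And>v. L a (D v) = h' v"
  shows "(Y has_derivative D) (at a)"
  unfolding has_derivative_iff_norm
proof
  define h where "h z = S z - L z (Y a)" for z
  define d where "d z = norm (h z - h a - h' (z - a)) / norm (z - a)" for z
  have d: "(d \<longlongrightarrow> 0) (at a)"
    using h unfolding has_derivative_iff_norm d_def h_def by blast
  obtain b where b: "\<And>v. norm (D v) \<le> norm v * b"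
    using bounded_linear.bounded[OF D(1)] by blast
  \<comment> \<open>Half of the lower bound c is given up to the perturbation, so \<open>L z\<close>
    is bounded below by c / 2.\<close>
  have "\<forall>\<^sub>F z in at a. e z < c / 2"
    using e(1) c(1) by (intro order_tendstoD) auto
  moreover have "\<forall>\<^sub>F z in at a. z \<noteq> a"
    by (simp add: eventually_at_filter)
  ultimately have bound: "\<forall>\<^sub>F z in at a.
      norm (norm (Y z - Y a - D (z - a)) / norm (z - a)) \<le> 2 / c * (d z + \<bar>e z\<bar> * b)"
    using sol(1)
  proof eventually_elim
    case (elim z)
    interpret L: linear "L z" by (rule lin)
    define W where "W = Y z - Y a - D (z - a)"
    have "h a = 0"
      using sol(2) by (simp add: h_def)
    \<comment> \<open>The error W of the linear approximation is mapped to the remainder of h plus a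
      perturbation of L applied to \<open>D (z - a)\<close>; both are o(|z - a|).\<close>
    have "L z W = (h z - h a - h' (z - a)) - (L z (D (z - a)) - L a (D (z - a)))"
      using elim(3) \<open>h a = 0\<close> D(2)[of "z - a"] by (simp add: W_def L.diff h_def)
    also have "norm \<dots> \<le> norm (h z - h a - h' (z - a)) + \<bar>e z\<bar> * (norm (z - a) * b)"
    proof (rule order_trans[OF norm_triangle_ineq4 add_left_mono])
      have "norm (L z (D (z - a)) - L a (D (z - a))) \<le> e z * norm (D (z - a))"
        by (rule e(2))
      also have "\<dots> \<le> \<bar>e z\<bar> * (norm (z - a) * b)"
        by (intro mult_mono b) auto
      finally show "norm (L z (D (z - a)) - L a (D (z - a))) \<le> \<bar>e z\<bar> * (norm (z - a) * b)" .
    qed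
    also have "\<dots> = (d z + \<bar>e z\<bar> * b) * norm (z - a)"
      using elim(2) by (simp add: d_def algebra_simps)
    finally have 1: "norm (L z W) \<le> (d z + \<bar>e z\<bar> * b) * norm (z - a)" .
    have "norm (L a W) \<le> norm (L z W) + norm (L z W - L a W)"
      using norm_triangle_sub[of "L a W" "L z W"] by (simp add: norm_minus_commute)
    also have "\<dots> \<le> norm (L z W) + c / 2 * norm W"
      using elim(1) by (intro add_left_mono order_trans[OF e(2)] mult_right_mono) auto
    finally have "c / 2 * norm W \<le> norm (L z W)"
      using c(2)[of W] by simp
    with 1 have "norm W \<le> 2 / c * ((d z + \<bar>e z\<bar> * b) * norm (z - a))"
      using c(1) by (simp add: field_simps)
    then show ?case
      using elim(2) c(1) by (simp add: W_def divide_le_eq algebra_simps)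
  qed
  have "((\<lambda>z. 2 / c * (d z + \<bar>e z\<bar> * b)) \<longlongrightarrow> 2 / c * (0 + \<bar>0\<bar> * b)) (at a)"
    by (intro tendsto_intros d e)
  then have "((\<lambda>z. 2 / c * (d z + \<bar>e z\<bar> * b)) \<longlongrightarrow> 0) (at a)"
    by (simp only: abs_zero mult_zero_left mult_zero_right add_0_left)
  then show "((\<lambda>z. norm (Y z - Y a - D (z - a)) / norm (z - a)) \<longlongrightarrow> 0) (at a)"
    by (rule Lim_null_comparison[OF bound])
qed (rule D)

text \<open>With N = M z - M a, the difference of the operators is -(N X (M z)^T + M a X N^T), and
  each term carries a factor N tending to 0.\<close>

lemma lyapunov_op_perturbation:
  fixes M :: "'a::real_normed_vector \<Rightarrow> real^'n^'n"
  assumes "isCont M a"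
  obtains e where "(e \<longlongrightarrow> 0) (at a)"
    "\<And>z X. norm ((X - M z ** X ** transpose (M z)) - (X - M a ** X ** transpose (M a))) \<le> e z * norm X"
proof -
  obtain k where k: "0 < k" "\<And>(P :: real^'n^'n) (Q :: real^'n^'n). norm (P ** Q) \<le> norm P * norm Q * k"
    using bounded_bilinear.pos_bounded[OF bounded_bilinear_matrix_mult] by blast
  have k3: "norm (P ** X ** Q) \<le> norm P * norm Q * (k * k) * norm X" for P X Q :: "real^'n^'n"
  proof -
    have "norm (P ** X ** Q) \<le> norm (P ** X) * norm Q * k"
      by (rule k)
    also have "\<dots> \<le> (norm P * norm X * k) * norm Q * k"
      using k by (intro mult_right_mono) auto
    finally show ?thesis
      by (simp add: mult_ac)
  qed
  define e where "e z = (norm (M z - M a) * norm (transpose (M z))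
    + norm (M a) * norm (transpose (M z - M a))) * (k * k)" for z
  have Ma: "(M \<longlongrightarrow> M a) (at a)"
    using assms by (simp add: isCont_def)
  have "(e \<longlongrightarrow> (norm (M a - M a) * norm (transpose (M a))
      + norm (M a) * norm (transpose (M a - M a))) * (k * k)) (at a)"
    unfolding e_def by (intro tendsto_intros tendsto_transpose Ma)
  then have "(e \<longlongrightarrow> 0) (at a)"
    by (simp add: transpose_0)
  moreover have "norm ((X - M z ** X ** transpose (M z)) - (X - M a ** X ** transpose (M a)))
      \<le> e z * norm X" for z X
  proof -
    define N where "N = M z - M a"
    have Mz: "M z = M a + N"
      by (simp add: N_def)
    have "(X - M z ** X ** transpose (M z)) - (X - M a ** X ** transpose (M a))
        = - (N ** X ** transpose (M z) + M a ** X ** transpose N)"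
      unfolding Mz transpose_plus by (simp add: matrix_add_ldistrib matrix_add_rdistrib)
    also have "norm \<dots> \<le> norm (N ** X ** transpose (M z)) + norm (M a ** X ** transpose N)"
      unfolding norm_minus_cancel by (rule norm_triangle_ineq)
    also have "\<dots> \<le> e z * norm X"
      using k3[of N X "transpose (M z)"] k3[of "M a" X "transpose N"]
      by (simp add: e_def N_def distrib_right)
    finally show ?thesis .
  qed
  ultimately show ?thesis
    using that by blast
qed

lemma has_derivative_dlyap:
  fixes M Z :: "'a::real_normed_vector \<Rightarrow> real^'n^'n"
  assumes M: "(M has_derivative M') (at a)" and Z: "(Z has_derivative Z') (at a)"
    and inj: "inj (\<lambda>X. X - M a ** X ** transpose (M a))"
  defines "Y \<equiv> dlyap (M a) (Z a)"
  shows "((\<lambda>z. dlyap (M z) (Z z)) has_derivative (\<lambda>v. dlyap (M a)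
    (M' v ** Y ** transpose (M a) + M a ** Y ** transpose (M' v) + Z' v))) (at a)"
proof -
  let ?L = "\<lambda>z X. X - M z ** X ** transpose (M z)"
  let ?h = "\<lambda>v. M' v ** Y ** transpose (M a) + M a ** Y ** transpose (M' v) + Z' v"
  obtain c where c: "0 < c" "\<And>X. c * norm X \<le> norm (?L a X)"
    by (rule linear_inj_bounded_below_pos[OF linear_lyapunov_op inj]) blast
  obtain e where e: "(e \<longlongrightarrow> 0) (at a)" "\<And>z X. norm (?L z X - ?L a X) \<le> e z * norm X"
    by (rule lyapunov_op_perturbation[OF has_derivative_continuous[OF M]]) blast
  have dlyap: "?L z (dlyap (M z) W) = W"
    if inj': "inj (?L z)" for z W
    using dlyap_unique[OF inj', of "dlyap (M z) W" W] by (simp add: diff_eq_eq add.commute)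
  \<comment> \<open>A perturbation smaller than the lower bound c keeps the operator injective, so
    \<open>dlyap\<close> solves the equation near a.\<close>
  have "\<forall>\<^sub>F z in at a. e z < c"
    using e(1) c(1) by (intro order_tendstoD) auto
  then have sol: "\<forall>\<^sub>F z in at a. ?L z (dlyap (M z) (Z z)) = Z z"
  proof eventually_elim
    case (elim z)
    have "X = 0" if "?L z X = 0" for X
    proof (rule ccontr)
      assume "X \<noteq> 0"
      have "norm (?L a X) \<le> e z * norm X"
        using e(2)[of X z] that by (simp add: norm_minus_commute)
      also have "\<dots> < c * norm X"
        using elim \<open>X \<noteq> 0\<close> by simp
      finally show False
        using c(2)[of X] by simp
    qed
    then have "inj (?L z)"
      unfolding linear_injective_0[OF linear_lyapunov_op] by blast
    then show ?case
      by (rule dlyap)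
  qed
  have h: "((\<lambda>z. Z z - ?L z Y) has_derivative ?h) (at a)"
    by (rule has_derivative_eq_rhs,
        (rule has_derivative_diff has_derivative_const has_derivative_matrix_mult
          has_derivative_transpose M Z)+)
      (auto simp: fun_eq_iff)
  have "bounded_linear (\<lambda>v. dlyap (M a) (?h v))"
    using bounded_linear_compose[OF _ has_derivative_bounded_linear[OF h]]
      linear_dlyap[OF inj] by (simp add: linear_conv_bounded_linear)
  then show ?thesis
    unfolding Y_def
    by (rule has_derivative_linear_solution[where L = ?L and Y = "\<lambda>z. dlyap (M z) (Z z)" and S = Z,
          OF linear_lyapunov_op c e sol dlyap[OF inj] h[unfolded Y_def] _ dlyap[OF inj]])
qed

section \<open>The Lyapunov metric and its Christoffel symbols\<close>

text \<open>Coordinate fields are constant, so this admits them to the axioms of the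
  connection.\<close>

lemma smooth_on_const: "smooth_on (\<lambda>_. c) S"
proof -
  have "Ck_on k (\<lambda>_. c) S" for k and c :: 'b
    by (induction k arbitrary: c) auto
  then show ?thesis
    by (simp add: smooth_on_def)
qed

section \<open>The metric in the coordinate frame\<close>

lemma coord_mat_nth: "coord_mat (i, j) $ a $ b = (if a = i \<and> b = j then 1 else 0)"
  by (auto simp: coord_mat_def axis_def)

lemma lyap_metric_eq_sum:
  "lyap_metric A B \<Sigma>1 \<Sigma>2 K V W
    = (\<Sum>b\<in>UNIV. \<Sum>c\<in>UNIV. \<Sum>a\<in>UNIV. V $ a $ b * W $ a $ c * Y_K A B \<Sigma>1 \<Sigma>2 K $ c $ b)"
  by (simp add: lyap_metric_def trace_def matrix_matrix_mult_def transpose_def sum_distrib_right)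

text \<open>Lowering an index: as s varies, these are the entries of row i of V times the transpose
  of \<open>Y_K\<close>.\<close>

lemma lyap_metric_coord_mat_right:
  "lyap_metric A B \<Sigma>1 \<Sigma>2 K V (coord_mat (i, s)) = (\<Sum>j\<in>UNIV. V $ i $ j * Y_K A B \<Sigma>1 \<Sigma>2 K $ s $ j)"
proof -
  have "V $ a $ b * coord_mat (i, s) $ a $ c * y = (if a = i then if c = s then V $ a $ b * y else 0 else 0)"
    for a b c y
    by (simp add: coord_mat_nth)
  then show ?thesis
    by (simp add: lyap_metric_eq_sum)
qed

lemma lyap_metric_coord_mat:
  "lyap_metric A B \<Sigma>1 \<Sigma>2 K (coord_mat (k, l)) (coord_mat (i, s))
    = (if k = i then Y_K A B \<Sigma>1 \<Sigma>2 K $ s $ l else 0)"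
  by (auto simp: lyap_metric_coord_mat_right coord_mat_nth if_distrib[of "\<lambda>x. x * _"] cong: if_cong)

lemma lyap_metric_commute:
  assumes "transpose (Y_K A B \<Sigma>1 \<Sigma>2 K) = Y_K A B \<Sigma>1 \<Sigma>2 K"
  shows "lyap_metric A B \<Sigma>1 \<Sigma>2 K V W = lyap_metric A B \<Sigma>1 \<Sigma>2 K W V"
proof -
  have "Y_K A B \<Sigma>1 \<Sigma>2 K $ c $ b = Y_K A B \<Sigma>1 \<Sigma>2 K $ b $ c" for b c
    using arg_cong[OF assms, of "\<lambda>Z. Z $ b $ c"] by (simp add: transpose_def)
  then show ?thesis
    unfolding lyap_metric_eq_sum by (subst sum.swap) (simp add: mult.commute)
qed

lemma sum_coord_mat_nth: "(\<Sum>c\<in>UNIV. x c * coord_mat c $ i $ j) = x (i, j)"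
proof -
  have "x c * coord_mat c $ i $ j = (if c = (i, j) then x c else 0)" for c
    by (cases c) (auto simp: coord_mat_nth)
  then show ?thesis
    by simp
qed

lemma psd_Sigma_K:
  assumes "psd \<Sigma>1" "psd \<Sigma>2"
  shows "psd (Sigma_K \<Sigma>1 \<Sigma>2 K)"
proof -
  have "x \<bullet> (Sigma_K \<Sigma>1 \<Sigma>2 K *v x) = x \<bullet> (\<Sigma>1 *v x) + (K *v x) \<bullet> (\<Sigma>2 *v (K *v x))" for x
    by (simp add: Sigma_K_def matrix_vector_mult_add_rdistrib inner_add_right dot_matrix_vector
        del: transpose_matrix_vector flip: matrix_vector_mul_assoc)
  then show ?thesis
    using assms
    by (simp add: psd_def Sigma_K_def transpose_plus matrix_transpose_mul matrix_mul_assoc)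
qed

text \<open>The derivative of the Lyapunov solution along \<open>A + B ** z\<close> and
  \<open>Sigma_K\<close>; in coordinate directions its right-hand side is the one in
  \<open>dY_K\<close>.\<close>

lemma has_derivative_Y_K:
  fixes A :: "real^'n^'n" and B :: "real^'m^'n"
  assumes "K \<in> stabilizing A B"
  obtains D where "(Y_K A B \<Sigma>1 \<Sigma>2 has_derivative D) (at K)"
    "\<And>a. D (coord_mat a) = dY_K A B \<Sigma>1 \<Sigma>2 K a"
proof
  let ?M = "\<lambda>z. A + B ** z"
  have M: "(?M has_derivative (\<lambda>v. B ** v)) (at K)"
    by (rule has_derivative_eq_rhs,
        (rule has_derivative_add has_derivative_const has_derivative_matrix_mult has_derivative_ident)+)
      (auto simp: fun_eq_iff)
  have Z: "(Sigma_K \<Sigma>1 \<Sigma>2 has_derivative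
      (\<lambda>v. transpose v ** \<Sigma>2 ** K + transpose K ** \<Sigma>2 ** v)) (at K)"
    unfolding Sigma_K_def[abs_def]
    by (rule has_derivative_eq_rhs,
        (rule has_derivative_add has_derivative_const has_derivative_matrix_mult
          has_derivative_transpose has_derivative_ident)+)
      (auto simp: fun_eq_iff)
  have inj: "inj (\<lambda>X. X - ?M K ** X ** transpose (?M K))"
    using assms by (intro inj_lyapunov_op) (simp add: stabilizing_def)
  show "(Y_K A B \<Sigma>1 \<Sigma>2 has_derivative (\<lambda>v. dlyap (?M K)
      (B ** v ** Y_K A B \<Sigma>1 \<Sigma>2 K ** transpose (?M K)
        + ?M K ** Y_K A B \<Sigma>1 \<Sigma>2 K ** transpose (B ** v)
        + (transpose v ** \<Sigma>2 ** K + transpose K ** \<Sigma>2 ** v)))) (at K)"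
    using has_derivative_dlyap[OF M Z inj] by (simp add: Y_K_def[abs_def])
  show "dlyap (?M K)
      (B ** coord_mat a ** Y_K A B \<Sigma>1 \<Sigma>2 K ** transpose (?M K)
        + ?M K ** Y_K A B \<Sigma>1 \<Sigma>2 K ** transpose (B ** coord_mat a)
        + (transpose (coord_mat a) ** \<Sigma>2 ** K + transpose K ** \<Sigma>2 ** coord_mat a))
      = dY_K A B \<Sigma>1 \<Sigma>2 K a" for a
    by (simp add: dY_K_def Let_def matrix_transpose_mul matrix_mul_assoc add.assoc)
qed

lemma transpose_Y_K:
  assumes "K \<in> stabilizing A B" "psd \<Sigma>1" "psd \<Sigma>2"
  shows "transpose (Y_K A B \<Sigma>1 \<Sigma>2 K) = Y_K A B \<Sigma>1 \<Sigma>2 K"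
  unfolding Y_K_def
  using assms psd_Sigma_K by (intro transpose_dlyap inj_lyapunov_op) (auto simp: stabilizing_def psd_def)

lemma transpose_dY_K:
  assumes K: "K \<in> stabilizing A B" and psd: "psd \<Sigma>1" "psd \<Sigma>2"
  shows "transpose (dY_K A B \<Sigma>1 \<Sigma>2 K a) = dY_K A B \<Sigma>1 \<Sigma>2 K a"
  unfolding dY_K_def Let_def
proof (rule transpose_dlyap)
  show "inj (\<lambda>X. X - (A + B ** K) ** X ** transpose (A + B ** K))"
    using K by (intro inj_lyapunov_op) (simp add: stabilizing_def)
  show "transpose (B ** coord_mat a ** Y_K A B \<Sigma>1 \<Sigma>2 K ** transpose (A + B ** K)
      + (A + B ** K) ** Y_K A B \<Sigma>1 \<Sigma>2 K ** transpose (coord_mat a) ** transpose B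
      + transpose (coord_mat a) ** \<Sigma>2 ** K + transpose K ** \<Sigma>2 ** coord_mat a)
    = B ** coord_mat a ** Y_K A B \<Sigma>1 \<Sigma>2 K ** transpose (A + B ** K)
      + (A + B ** K) ** Y_K A B \<Sigma>1 \<Sigma>2 K ** transpose (coord_mat a) ** transpose B
      + transpose (coord_mat a) ** \<Sigma>2 ** K + transpose K ** \<Sigma>2 ** coord_mat a"
    unfolding transpose_plus matrix_transpose_mul transpose_Y_K[OF K psd]
    using psd(2) by (simp add: psd_def matrix_transpose_mul transpose_plus matrix_mul_assoc add_ac)
qed

lemma vf_deriv_lyap_metric_coord_mat:
  assumes K: "K \<in> stabilizing A B" and psd: "psd \<Sigma>1" "psd \<Sigma>2"
  shows "vf_deriv (\<lambda>_. coord_mat a) (\<lambda>z. lyap_metric A B \<Sigma>1 \<Sigma>2 z (coord_mat (k, l)) (coord_mat (i, s))) K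
    = (if k = i then dY_K A B \<Sigma>1 \<Sigma>2 K a $ s $ l else 0)"
proof -
  obtain D where D: "(Y_K A B \<Sigma>1 \<Sigma>2 has_derivative D) (at K)"
    "\<And>a. D (coord_mat a) = dY_K A B \<Sigma>1 \<Sigma>2 K a"
    using has_derivative_Y_K[OF K] by blast
  have "((\<lambda>z. Y_K A B \<Sigma>1 \<Sigma>2 z $ s $ l) has_derivative (\<lambda>v. D v $ s $ l)) (at K)"
    by (intro bounded_linear.has_derivative[OF bounded_linear_vec_nth] D)
  from frechet_derivative_at[OF this, symmetric] show ?thesis
    by (simp add: vf_deriv_def lyap_metric_coord_mat D(2))
qed

text \<open>Brackets of constant fields vanish, so the connection is symmetric on them, and the
  signed sum of three compatibility identities leaves one term twice.\<close>

lemma koszul_formula_const: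
  fixes conn :: "('a::euclidean_space \<Rightarrow> 'a) \<Rightarrow> ('a \<Rightarrow> 'a) \<Rightarrow> 'a \<Rightarrow> 'a"
  assumes LC: "levi_civita S g conn" and K: "K \<in> S" and sym: "\<And>V W. g K V W = g K W V"
  shows "2 * g K (conn (\<lambda>_. u) (\<lambda>_. v) K) w
    = vf_deriv (\<lambda>_. u) (\<lambda>z. g z v w) K + vf_deriv (\<lambda>_. v) (\<lambda>z. g z u w) K
      - vf_deriv (\<lambda>_. w) (\<lambda>z. g z u v) K"
proof -
  have compat: "vf_deriv (\<lambda>_. a) (\<lambda>z. g z b c) K
      = g K (conn (\<lambda>_. a) (\<lambda>_. b) K) c + g K b (conn (\<lambda>_. a) (\<lambda>_. c) K)" for a b c
    using LC K smooth_on_const[of a S] smooth_on_const[of b S] smooth_on_const[of c S]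
    unfolding levi_civita_def metric_compatible_def by blast
  have torsion: "conn (\<lambda>_. a) (\<lambda>_. b) K = conn (\<lambda>_. b) (\<lambda>_. a) K" for a b
  proof -
    have "conn (\<lambda>_. a) (\<lambda>_. b) K - conn (\<lambda>_. b) (\<lambda>_. a) K = lie_bracket (\<lambda>_. a) (\<lambda>_. b) K"
      using LC K smooth_on_const[of a S] smooth_on_const[of b S]
      unfolding levi_civita_def torsion_free_def by blast
    then show ?thesis
      by (simp add: lie_bracket_def vf_deriv_def)
  qed
  show ?thesis
    unfolding compat torsion[of v u] torsion[of w u] torsion[of w v]
    using sym by simp
qed

theorem mainTheorem5:
  fixes A :: "real^'n^'n" and B :: "real^'m^'n"
    and \<Sigma>1 :: "real^'n^'n" and \<Sigma>2 :: "real^'m^'m"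
    and conn :: "(real^'n^'m \<Rightarrow> real^'n^'m) \<Rightarrow> (real^'n^'m \<Rightarrow> real^'n^'m) \<Rightarrow> real^'n^'m \<Rightarrow> real^'n^'m"
    and \<Gamma> :: "'m \<times> 'n \<Rightarrow> 'm \<times> 'n \<Rightarrow> 'm \<times> 'n \<Rightarrow> real^'n^'m \<Rightarrow> real"
    and K :: "real^'n^'m"
    and i k p :: 'm and j l q :: 'n
  defines "Y \<equiv> Y_K A B \<Sigma>1 \<Sigma>2 K" and "dY \<equiv> \<lambda>a b. dY_K A B \<Sigma>1 \<Sigma>2 K (a, b)"
  assumes stab: "stabilizable A B"
    and psd: "psd \<Sigma>1" "psd \<Sigma>2"
    and ctrb: "\<forall>K\<in>stabilizing A B. controllable (A + B ** K) (psd_sqrt (Sigma_K \<Sigma>1 \<Sigma>2 K))"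
    and LC: "levi_civita (stabilizing A B) (lyap_metric A B \<Sigma>1 \<Sigma>2) conn"
    and Chr: "christoffel_symbols (stabilizing A B) conn \<Gamma>"
    and K: "K \<in> stabilizing A B"
  shows "\<Gamma> (i, j) (k, l) (p, q) K =
    (if k = i \<and> i \<noteq> p then 1/2 * (dY p q ** matrix_inv Y) $ l $ j
     else if p = i \<and> i \<noteq> k then 1/2 * (dY k l ** matrix_inv Y) $ q $ j
     else if p = k \<and> k \<noteq> i then - (1/2) * (\<Sum>s\<in>UNIV. dY i s $ q $ l * matrix_inv Y $ s $ j)
     else if p = k \<and> k = i then
       1/2 * (\<Sum>s\<in>UNIV. (dY i l $ q $ s + dY i q $ l $ s - dY i s $ q $ l) * matrix_inv Y $ s $ j)
     else 0)"
proof -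
  have symY: "transpose Y = Y"
    unfolding Y_def by (rule transpose_Y_K[OF K psd])
  then have Y_swap: "Y $ s $ j = Y $ j $ s" for s j
    by (metis transpose_def vec_lambda_beta)
  have dY_swap: "dY a b $ s $ t = dY a b $ t $ s" for a b s t
    using arg_cong[OF transpose_dY_K[OF K psd, of "(a, b)"], of "\<lambda>Z. Z $ t $ s"]
    by (simp add: dY_def transpose_def)
  have "invertible Y"
    unfolding Y_def Y_K_def
    using K ctrb psd by (intro invertible_dlyap psd_Sigma_K) (auto simp: stabilizing_def)
  then have inv: "Y ** matrix_inv Y = mat 1"
    unfolding invertible_def matrix_inv_def by (rule someI_ex[THEN conjunct1])
  let ?N = "conn (\<lambda>_. coord_mat (k, l)) (\<lambda>_. coord_mat (p, q)) K"
  \<comment> \<open>The right side of the Koszul formula for the third field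
    \<open>coord_mat (i, s)\<close>, with indices ordered by the symmetry of \<open>dY\<close>. Each
    summand survives only if its two row indices agree.\<close>
  define G where "G s = (if p = i then dY k l $ q $ s else 0) + (if k = i then dY p q $ l $ s else 0)
    - (if k = p then dY i s $ q $ l else 0)" for s
  have N: "?N $ i $ j = \<Gamma> (i, j) (k, l) (p, q) K" for j
    using Chr K by (simp add: christoffel_symbols_def sum_coord_mat_nth)
  have "2 * (\<Sum>t\<in>UNIV. ?N $ i $ t * Y $ s $ t) = G s" for s
    using koszul_formula_const[OF LC K lyap_metric_commute[OF transpose_Y_K[OF K psd]],
        of "coord_mat (k, l)" "coord_mat (p, q)" "coord_mat (i, s)"]
    unfolding vf_deriv_lyap_metric_coord_mat[OF K psd]
    by (simp add: lyap_metric_coord_mat_right G_def dY_swap[of _ _ s q, unfolded dY_def]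
        dY_swap[of _ _ s l, unfolded dY_def] Y_def dY_def)
  \<comment> \<open>The equations for all s together are one row-vector equation, by symmetry of Y;
    multiplying by the inverse of Y on the right raises the index.\<close>
  then have "2 *\<^sub>R (?N $ i v* Y) = (\<chi> s. G s)"
    by (simp add: vec_eq_iff vector_matrix_mult_def Y_swap mult.commute)
  then have "(2 *\<^sub>R (?N $ i v* Y)) v* matrix_inv Y = (\<chi> s. G s) v* matrix_inv Y"
    by simp
  then have "2 *\<^sub>R (?N $ i) = (\<chi> s. G s) v* matrix_inv Y"
    by (simp add: vector_matrix_mul_assoc inv scaleR_vector_matrix_assoc)
  then have eq: "\<Gamma> (i, j) (k, l) (p, q) K = 1/2 * (\<Sum>s\<in>UNIV. G s * matrix_inv Y $ s $ j)"
    by (simp add: vec_eq_iff N vector_matrix_mult_def mult.commute)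
  \<comment> \<open>The cases are the patterns of equality among i, k and p; in the last all three
    differ and every summand of G is 0.\<close>
  consider "k = i" "i \<noteq> p" | "p = i" "i \<noteq> k" | "p = k" "k \<noteq> i" | "p = k" "k = i"
    | "k \<noteq> i" "p \<noteq> i" "p \<noteq> k"
    by blast
  then show ?thesis
  proof cases
    case 1
    then have "G s = dY p q $ l $ s" for s
      by (simp add: G_def)
    then show ?thesis
      unfolding eq using 1 by (simp add: matrix_matrix_mult_def)
  next
    case 2
    then have "G s = dY k l $ q $ s" for s
      by (simp add: G_def)
    then show ?thesis
      unfolding eq using 2 by (simp add: matrix_matrix_mult_def)
  next
    case 3
    then have "G s = - dY i s $ q $ l" for s
      by (simp add: G_def)
    then show ?thesis
      unfolding eq using 3 by (simp add: sum_negf)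
  next
    case 4
    then have "G s = dY i l $ q $ s + dY i q $ l $ s - dY i s $ q $ l" for s
      by (simp add: G_def)
    then show ?thesis
      unfolding eq using 4 by simp
  next
    case 5
    then have "G s = 0" for s
      by (simp add: G_def)
    then show ?thesis
      unfolding eq using 5 by simp
  qed
qed

end
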